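(* Let $G$ be a countable finitely generated discrete group, $H\le G$ a subgroup, and $X=G/H$. Let $0<\theta<1$ and let $q$ be determined by $\frac1q=1-\frac\theta2$ (equivalently $q=\frac{2}{2-\theta}\in(1,2)$). Let $w:G\to(0,\infty)$ be a strictly positive function and let $\beta_0,\beta_1\in\mathbb{R}$. Set $\beta_\theta:=(1-\theta)\beta_0+\theta\beta_1$. Assume: (a) $M_0:=\|w^{-\beta_0}\|_{\ell^\infty(G)}<\infty$; (b) there exists $M_1>0$ such that for all $f\in\mathbb{C}G$ and all $\xi\in\ell^2(X)$, $$\|\lambda_X(f)\xi\|_2\le M_1\,\bigl\|\pi_\#\bigl(|f|\,w^{\beta_1}\bigr)\bigr\|_{\ell^2(X)}\,\|\xi\|_2.$$ Then for every $f\in\mathbb{C}G$ one has $$\|\lambda_{X,q}(f)\|_{B(\ell^q(X))}\le M_0^{1-\theta}M_1^{\theta}\,\bigl\|\pi_\#\bigl(|f|\,w^{\beta_\theta}\bigr)\bigr\|_{\ell^q(X)}.$$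
   Context: $\mathbb{C}G$ is the group algebra (finitely supported functions on $G$). For a nonnegative function $F$ on $G$, $\pi_\#F:X\to[0,\infty]$ is the fiber sum $(\pi_\#F)(x)=\sum_{g\in G,\ gH=x}F(g)$. For $1\le q\le\infty$, the quasi-regular representation on $\ell^q(X)$ is $(\lambda_{X,q}(g)\xi)(x)=\xi(g^{-1}x)$, extended linearly by $\lambda_{X,q}(f)=\sum_gf(g)\lambda_{X,q}(g)$; $\lambda_X(f)$ denotes the same formula acting on functions on $X$ (here on $\ell^2(X)$). *)

theory Defs
  imports "HOL-Analysis.Analysis" "HOL-Algebra.Left_Coset" "HOL-Algebra.Generated_Groups"
begin

definition finitely_generated_group :: "('a, 'b) monoid_scheme \<Rightarrow> bool" where
  "finitely_generated_group G \<longleftrightarrow>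
     group G \<and> (\<exists>S. finite S \<and> S \<subseteq> carrier G \<and> generate G S = carrier G)"

(* Complex functions on S (a group or a coset space) are represented by total functions.
   All norms, fiber sums and operators below only read the values on the relevant set.
   The [0, \<infinity>]-valued setting keeps divergent sums and unbounded suprema at \<infinity>, where real
   infsum and Sup would return unspecified or zero values. *)

(* Only meant for p > 0, as \<infinity> is sent to \<infinity>. *)
definition ennpowr :: "ennreal \<Rightarrow> real \<Rightarrow> ennreal" where
  "ennpowr a p = (if a = \<infinity> then \<infinity> else ennreal (enn2real a powr p))"

definition ell_ennnorm :: "real \<Rightarrow> 's set \<Rightarrow> ('s \<Rightarrow> ennreal) \<Rightarrow> ennreal" where
  "ell_ennnorm q S F = ennpowr (\<Sum>\<^sub>\<infinity>x\<in>S. ennpowr (F x) q) (1 / q)"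

definition ell_norm :: "real \<Rightarrow> 's set \<Rightarrow> ('s \<Rightarrow> complex) \<Rightarrow> ennreal" where
  "ell_norm q S \<xi> = ell_ennnorm q S (\<lambda>x. ennreal (cmod (\<xi> x)))"

definition ell_inf_norm :: "'s set \<Rightarrow> ('s \<Rightarrow> real) \<Rightarrow> ennreal" where
  "ell_inf_norm S F = (SUP x\<in>S. ennreal \<bar>F x\<bar>)"

definition ell_space :: "real \<Rightarrow> 's set \<Rightarrow> ('s \<Rightarrow> complex) set" where
  "ell_space q S = {\<xi>. ell_norm q S \<xi> < \<infinity>}"

(* A finite value says in particular that T maps ell_space q S into itself. *)
definition ell_opnorm ::
  "real \<Rightarrow> 's set \<Rightarrow> (('s \<Rightarrow> complex) \<Rightarrow> ('s \<Rightarrow> complex)) \<Rightarrow> ennreal" where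
  "ell_opnorm q S T = (SUP \<xi>\<in>{\<xi> \<in> ell_space q S. ell_norm q S \<xi> \<le> 1}. ell_norm q S (T \<xi>))"

definition group_algebra :: "('a, 'b) monoid_scheme \<Rightarrow> ('a \<Rightarrow> complex) set" where
  "group_algebra G = {f. finite {g. f g \<noteq> 0} \<and> {g. f g \<noteq> 0} \<subseteq> carrier G}"

definition fiber_sum ::
  "('a, 'b) monoid_scheme \<Rightarrow> 'a set \<Rightarrow> ('a \<Rightarrow> real) \<Rightarrow> 'a set \<Rightarrow> ennreal" where
  "fiber_sum G H F x = (\<Sum>\<^sub>\<infinity>g\<in>{g \<in> carrier G. g <#\<^bsub>G\<^esub> H = x}. ennreal (F g))"

(* On left cosets, y <# (g <# H) is the coset (y g)H, so <# is the action of G on G/H. *)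
definition quasi_regular ::
  "('a, 'b) monoid_scheme \<Rightarrow> 'a \<Rightarrow> ('a set \<Rightarrow> complex) \<Rightarrow> 'a set \<Rightarrow> complex" where
  "quasi_regular G g \<xi> x = \<xi> (inv\<^bsub>G\<^esub> g <#\<^bsub>G\<^esub> x)"

definition quasi_regular_alg ::
  "('a, 'b) monoid_scheme \<Rightarrow> ('a \<Rightarrow> complex) \<Rightarrow> ('a set \<Rightarrow> complex) \<Rightarrow> 'a set \<Rightarrow> complex" where
  "quasi_regular_alg G f \<xi> x = (\<Sum>g | f g \<noteq> 0. f g * quasi_regular G g \<xi> x)"

end

theory Submission
  imports Defs
begin

text \<open>
  Absolute values turn every operator in sight into a positive one, so two applications of Hoelder's
  inequality replace complex interpolation. Let \<open>F\<close> be the fiber sum of \<open>|f| w^\<beta>\<theta>\<close>, let \<open>\<xi>\<close> lie in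
  the unit ball of \<open>\<ell>^q\<close>, and put \<open>f0 w^\<beta>0 = |f| w^\<beta>\<theta> F^(q-1)\<close>, \<open>f1 w^\<beta>1 = |f| w^\<beta>\<theta> F^(q/2-1)\<close> with
  \<open>F\<close> evaluated at \<open>gH\<close>, \<open>\<xi>0 = |\<xi>|^q\<close> and \<open>\<xi>1 = |\<xi>|^(q/2)\<close>. Then \<open>|f| = f0^(1-\<theta>) f1^\<theta>\<close> and
  \<open>|\<xi>| = \<xi>0^(1-\<theta>) \<xi>1^\<theta>\<close>, so Hoelder over \<open>g\<close> gives
  \<open>|\<lambda>(f)\<xi>| \<le> (\<lambda>(f0)\<xi>0)^(1-\<theta>) (\<lambda>(f1)\<xi>1)^\<theta>\<close> pointwise. The two factors are controlled in \<open>\<ell>^1\<close> by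
  \<open>M0 N\<close> and in \<open>\<ell>^2\<close> by \<open>M1 N^(1/2)\<close>, where \<open>N\<close> is the sum of \<open>F^q\<close> over the cosets, and
  Hoelder over the cosets combines these bounds.
\<close>

section \<open>Hoelder's inequality for finite sums\<close>

text \<open>Dividing \<open>a\<close> and \<open>b\<close> by their sums reduces the claim to
  Young's inequality term by term; the resulting right sides add up to \<open>s + t = 1\<close>. If
  one of the sums vanishes, every product on the left is 0, and over an infinite \<open>I\<close>
  the left sum is 0 by convention.\<close>

lemma Holder_sum_powr:
  fixes a b :: "'i \<Rightarrow> real" and s t :: real
  assumes "0 < s" "0 < t" "s + t = 1"
    and a: "\<And>i. i \<in> I \<Longrightarrow> 0 \<le> a i" and b: "\<And>i. i \<in> I \<Longrightarrow> 0 \<le> b i"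
  shows "(\<Sum>i\<in>I. a i powr s * b i powr t) \<le> (\<Sum>i\<in>I. a i) powr s * (\<Sum>i\<in>I. b i) powr t"
proof (cases "finite I \<and> 0 < sum a I \<and> 0 < sum b I")
  case False
  have "\<forall>i\<in>I. a i powr s * b i powr t = 0" if "finite I"
  proof -
    have "sum a I = 0 \<or> sum b I = 0"
      using False that a b by (metis less_eq_real_def sum_nonneg)
    then show ?thesis
      using that a b by (auto simp: sum_nonneg_eq_0_iff)
  qed
  then have "(\<Sum>i\<in>I. a i powr s * b i powr t) = 0"
    by (cases "finite I") (auto intro!: sum.neutral)
  then show ?thesis by simp
next
  case True
  define A where "A = sum a I"
  define B where "B = sum b I"
  have pos: "0 < A" "0 < B" using True by (auto simp: A_def B_def)
  have young: "(a i / A) powr s * (b i / B) powr t \<le> s * (a i / A) + t * (b i / B)" if "i \<in> I" for i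
  proof (cases "a i = 0 \<or> b i = 0")
    case True
    then show ?thesis using pos a[OF that] b[OF that] assms(1,2) by auto
  next
    case False
    then show ?thesis using pos a[OF that] b[OF that] assms(1-3)
      by (intro Youngs_inequality_0) (auto simp: less_eq_real_def)
  qed
  have "(\<Sum>i\<in>I. a i powr s * b i powr t)
      = A powr s * B powr t * (\<Sum>i\<in>I. (a i / A) powr s * (b i / B) powr t)"
    unfolding sum_distrib_left using pos a b
    by (intro sum.cong) (auto simp: powr_divide)
  also have "\<dots> \<le> A powr s * B powr t * (\<Sum>i\<in>I. s * (a i / A) + t * (b i / B))"
    by (intro mult_left_mono sum_mono young) auto
  also have "(\<Sum>i\<in>I. s * (a i / A) + t * (b i / B)) = s * (A / A) + t * (B / B)"
    by (simp add: sum.distrib A_def B_def flip: sum_distrib_left sum_divide_distrib)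
  also have "\<dots> = 1" using pos assms(3) by simp
  finally show ?thesis by (simp add: A_def B_def)
qed

section \<open>Norms in [0, \<infinity>] as bounds on real finite sums\<close>

lemma ennpowr_ennreal: "0 \<le> a \<Longrightarrow> ennpowr (ennreal a) p = ennreal (a powr p)"
  by (simp add: ennpowr_def)

lemma infsum_ennreal_le_iff:
  fixes F :: "'s \<Rightarrow> real"
  assumes "\<And>x. x \<in> S \<Longrightarrow> 0 \<le> F x" and "0 \<le> c"
  shows "(\<Sum>\<^sub>\<infinity>x\<in>S. ennreal (F x)) \<le> ennreal c
           \<longleftrightarrow> (\<forall>A. finite A \<and> A \<subseteq> S \<longrightarrow> (\<Sum>x\<in>A. F x) \<le> c)"
proof -
  have "(\<Sum>x\<in>A. ennreal (F x)) \<le> ennreal c \<longleftrightarrow> (\<Sum>x\<in>A. F x) \<le> c" if "A \<subseteq> S" for A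
  proof -
    have "(\<Sum>x\<in>A. ennreal (F x)) = ennreal (\<Sum>x\<in>A. F x)"
      using assms that by (intro sum_ennreal) auto
    then show ?thesis using assms(2) by (simp add: ennreal_le_iff)
  qed
  then show ?thesis
    by (subst nonneg_infsum_complete) (auto simp: SUP_le_iff)
qed

text \<open>Both power maps are monotone and inverse to each other on nonnegative reals; for
  \<open>a = \<infinity>\<close> both sides fail, because their right-hand bounds are
  finite.\<close>

lemma ennpowr_inverse_le_iff:
  assumes "0 < p" "0 \<le> c"
  shows "ennpowr a (1 / p) \<le> ennreal c \<longleftrightarrow> a \<le> ennreal (c powr p)"
proof (cases a)
  case (real r)
  have "r powr (1 / p) \<le> c \<longleftrightarrow> r \<le> c powr p"
  proof
    assume "r powr (1 / p) \<le> c"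
    then have "(r powr (1 / p)) powr p \<le> c powr p"
      using assms by (intro powr_mono2) auto
    then show "r \<le> c powr p" using real assms by (simp add: powr_powr)
  next
    assume "r \<le> c powr p"
    then have "r powr (1 / p) \<le> (c powr p) powr (1 / p)"
      using real assms by (intro powr_mono2) auto
    then show "r powr (1 / p) \<le> c" using assms by (simp add: powr_powr)
  qed
  then show ?thesis using real assms by (simp add: ennpowr_ennreal ennreal_le_iff)
qed (simp add: ennpowr_def top_unique)

text \<open>A sum of nonnegative terms is the supremum of its finite partial sums. This serves in
  both directions: to unpack the bounds on \<open>\<xi>\<close> and on the operator in
  \<open>\<ell>^2\<close>, and to establish the final bound, so that all estimates take place among
  real finite sums.\<close>

lemma ell_norm_le_iff:
  assumes "0 < p" "0 \<le> c"
  shows "ell_norm p S \<xi> \<le> ennreal c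
           \<longleftrightarrow> (\<forall>A. finite A \<and> A \<subseteq> S \<longrightarrow> (\<Sum>x\<in>A. cmod (\<xi> x) powr p) \<le> c powr p)"
  using assms
  by (simp add: ell_norm_def ell_ennnorm_def ennpowr_inverse_le_iff ennpowr_ennreal
      infsum_ennreal_le_iff)

lemma ell_ennnorm_finite_support:
  fixes F :: "'s \<Rightarrow> real"
  assumes "finite A" "A \<subseteq> S" "\<And>x. x \<in> S \<Longrightarrow> 0 \<le> F x" "\<And>x. x \<in> S - A \<Longrightarrow> F x = 0"
  shows "ell_ennnorm p S (\<lambda>x. ennreal (F x)) = ennreal ((\<Sum>x\<in>A. F x powr p) powr (1 / p))"
proof -
  have "(\<Sum>\<^sub>\<infinity>x\<in>S. ennpowr (ennreal (F x)) p) = (\<Sum>\<^sub>\<infinity>x\<in>A. ennreal (F x powr p))"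
    using assms by (intro infsum_cong_neutral) (auto simp: ennpowr_ennreal ennpowr_def)
  also have "\<dots> = ennreal (\<Sum>x\<in>A. F x powr p)"
    using assms by simp
  finally show ?thesis
    by (simp add: ell_ennnorm_def ennpowr_ennreal sum_nonneg)
qed

section \<open>Fiber sums of finitely supported functions\<close>

lemma fiber_sum_finite_support:
  fixes F :: "'a \<Rightarrow> real"
  assumes "finite S" "S \<subseteq> carrier G" "\<And>g. 0 \<le> F g" "\<And>g. g \<notin> S \<Longrightarrow> F g = 0"
  shows "fiber_sum G H F x = ennreal (\<Sum>g | g \<in> S \<and> g <#\<^bsub>G\<^esub> H = x. F g)"
proof -
  have "fiber_sum G H F x = (\<Sum>\<^sub>\<infinity>g\<in>{g \<in> S. g <#\<^bsub>G\<^esub> H = x}. ennreal (F g))"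
    unfolding fiber_sum_def using assms by (intro infsum_cong_neutral) auto
  then show ?thesis using assms by simp
qed

text \<open>Only the finitely many cosets that meet \<open>S\<close> contribute, since
  \<open>0 powr p = 0\<close>, so the norm is a real number.\<close>

lemma ell_ennnorm_fiber_sum:
  fixes F :: "'a \<Rightarrow> real"
  assumes "finite S" "S \<subseteq> carrier G" "\<And>g. 0 \<le> F g" "\<And>g. g \<notin> S \<Longrightarrow> F g = 0"
  shows "ell_ennnorm p (lcosets\<^bsub>G\<^esub> H) (fiber_sum G H F)
    = ennreal ((\<Sum>x\<in>(\<lambda>g. g <#\<^bsub>G\<^esub> H) ` S. (\<Sum>g | g \<in> S \<and> g <#\<^bsub>G\<^esub> H = x. F g) powr p) powr (1 / p))"
proof -
  have *: "(\<Sum>g | g \<in> S \<and> g <#\<^bsub>G\<^esub> H = x. F g) = 0"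
    if "x \<notin> (\<lambda>g. g <#\<^bsub>G\<^esub> H) ` S" for x
    using that by (intro sum.neutral) auto
  have "fiber_sum G H F = (\<lambda>x. ennreal (\<Sum>g | g \<in> S \<and> g <#\<^bsub>G\<^esub> H = x. F g))"
    by (rule ext) (rule fiber_sum_finite_support[OF assms])
  then show ?thesis
    using assms by (simp only:, intro ell_ennnorm_finite_support)
      (auto simp: LCOSETS_def sum_nonneg intro!: *)
qed

section \<open>Translation of cosets and the bound in \<open>\<ell>^1\<close>\<close>

lemma (in group) l_coset_lcosets:
  assumes "subgroup H G" "g \<in> carrier G" "x \<in> lcosets H"
  shows "g <#\<^bsub>G\<^esub> x \<in> lcosets H"
  using assms by (auto simp: LCOSETS_def lcos_m_assoc subgroup.subset)

lemma (in group) inj_on_l_coset_lcosets: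
  assumes "subgroup H G" "g \<in> carrier G"
  shows "inj_on (\<lambda>x. g <#\<^bsub>G\<^esub> x) (lcosets H)"
proof (rule inj_on_inverseI)
  fix x assume "x \<in> lcosets H"
  then have "x \<subseteq> carrier G"
    using assms(1) lcosets_subset_PowG by blast
  then show "inv g <#\<^bsub>G\<^esub> (g <#\<^bsub>G\<^esub> x) = x"
    using assms by (simp add: lcos_m_assoc lcos_mult_one)
qed

text \<open>Translation is injective on the cosets, so every translate of \<open>\<eta>\<close>
  inherits the bound 1 on finite partial sums. Exchanging the two sums then leaves only the total
  mass of \<open>c\<close>.\<close>

lemma (in group) sum_quasi_regular_le:
  assumes H: "subgroup H G" and "finite S" "S \<subseteq> carrier G"
    and c: "\<And>g. g \<in> S \<Longrightarrow> 0 \<le> c g"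
    and \<eta>: "\<And>A. finite A \<Longrightarrow> A \<subseteq> lcosets H \<Longrightarrow> (\<Sum>x\<in>A. \<eta> x) \<le> (1::real)"
    and A: "finite A" "A \<subseteq> lcosets H"
  shows "(\<Sum>x\<in>A. \<Sum>g\<in>S. c g * \<eta> (inv g <#\<^bsub>G\<^esub> x)) \<le> (\<Sum>g\<in>S. c g)"
proof -
  have "(\<Sum>x\<in>A. \<eta> (inv g <#\<^bsub>G\<^esub> x)) \<le> 1" if "g \<in> S" for g
  proof -
    have g: "inv g \<in> carrier G" using that assms(3) by auto
    have "(\<Sum>x\<in>A. \<eta> (inv g <#\<^bsub>G\<^esub> x)) = (\<Sum>x\<in>(\<lambda>x. inv g <#\<^bsub>G\<^esub> x) ` A. \<eta> x)"
      using inj_on_subset[OF inj_on_l_coset_lcosets[OF H g] A(2)] by (simp add: sum.reindex)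
    also have "\<dots> \<le> 1"
      using A l_coset_lcosets[OF H g] by (intro \<eta>) auto
    finally show ?thesis .
  qed
  then have "(\<Sum>g\<in>S. c g * (\<Sum>x\<in>A. \<eta> (inv g <#\<^bsub>G\<^esub> x))) \<le> (\<Sum>g\<in>S. c g * 1)"
    using c by (intro sum_mono mult_left_mono)
  then show ?thesis
    by (subst sum.swap) (simp add: sum_distrib_left)
qed

section \<open>Interpolation between the bounds in \<open>\<ell>^1\<close> and
  \<open>\<ell>^2\<close>\<close>

theorem proposition2p7:
  fixes G :: "('a, 'b) monoid_scheme"
    and H :: "'a set"
    and X :: "'a set set"
    and \<theta> q \<beta>0 \<beta>1 \<beta>\<theta> M1 :: real
    and w :: "'a \<Rightarrow> real"
    and M0 :: ennreal
  assumes "group G"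
    and "countable (carrier G)"
    and "finitely_generated_group G"
    and "subgroup H G"
    and "X = lcosets\<^bsub>G\<^esub> H"
    and "0 < \<theta>" and "\<theta> < 1"
    and "1 / q = 1 - \<theta> / 2"
    and "\<And>g. g \<in> carrier G \<Longrightarrow> 0 < w g"
    and "\<beta>\<theta> = (1 - \<theta>) * \<beta>0 + \<theta> * \<beta>1"
    and "M0 = ell_inf_norm (carrier G) (\<lambda>g. w g powr (- \<beta>0))"
    and "M0 < \<infinity>"
    and "0 < M1"
    and "\<And>f \<xi>. f \<in> group_algebra G \<Longrightarrow> \<xi> \<in> ell_space 2 X \<Longrightarrow>
           ell_norm 2 X (quasi_regular_alg G f \<xi>)
             \<le> ennreal M1 * ell_ennnorm 2 X (fiber_sum G H (\<lambda>g. cmod (f g) * w g powr \<beta>1))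
                 * ell_norm 2 X \<xi>"
  shows "\<forall>f \<in> group_algebra G.
           ell_opnorm q X (quasi_regular_alg G f)
             \<le> ennpowr M0 (1 - \<theta>) * ennreal (M1 powr \<theta>)
                 * ell_ennnorm q X (fiber_sum G H (\<lambda>g. cmod (f g) * w g powr \<beta>\<theta>))"
proof
  fix f assume f: "f \<in> group_algebra G"
  interpret group G by fact
  have H: "subgroup H G" and X: "X = lcosets\<^bsub>G\<^esub> H" and \<theta>: "0 < \<theta>" "\<theta> < 1" by fact+
  note w = \<open>\<And>g. g \<in> carrier G \<Longrightarrow> 0 < w g\<close>
  have q_eq: "1 / q = 1 - \<theta> / 2" by fact
  have q_pos: "0 < q"
    using q_eq \<theta> zero_less_divide_1_iff[of q] by linarith
  have q_lin: "q * (1 - \<theta> / 2) = 1"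
    using q_pos by (simp flip: q_eq)
  \<comment> \<open>These two numbers are the Hoelder exponents over the cosets. The same identity
    makes the powers of \<open>\<phi>\<close> cancel in \<open>c_interp\<close> and those of
    \<open>\<xi>\<close> recombine in \<open>\<xi>_interp\<close>.\<close>
  then have q_sum: "(1 - \<theta>) * q + \<theta> * q / 2 = 1"
    by (simp add: algebra_simps)
  have "1 / q < 1" using q_eq \<theta> by linarith
  then have q: "1 < q" using q_pos by simp
  define S where "S = {g. f g \<noteq> 0}"
  have finS: "finite S" and SG: "S \<subseteq> carrier G"
    using f by (auto simp: group_algebra_def S_def)
  define u where "u g = cmod (f g) * w g powr \<beta>\<theta>" for g
  have u_nonneg: "0 \<le> u g" for g by (simp add: u_def)
  have u_pos: "0 < u g" if "g \<in> S" for g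
    using that SG w[of g] by (auto simp: u_def S_def)
  have u_zero: "u g = 0" if "g \<notin> S" for g
    using that by (simp add: u_def S_def)
  define \<phi> where "\<phi> x = (\<Sum>g | g \<in> S \<and> g <#\<^bsub>G\<^esub> H = x. u g)" for x
  define C where "C = (\<lambda>g. g <#\<^bsub>G\<^esub> H) ` S"
  define N where "N = (\<Sum>x\<in>C. \<phi> x powr q)"
  \<comment> \<open>Strict positivity matters because \<open>\<phi>\<close> is later raised to the
    negative exponent \<open>q / 2 - 1\<close>; at 0 the value of \<open>powr\<close> would be 0 and
    the cancellation in \<open>c_interp\<close> would break.\<close>
  have \<phi>_pos: "0 < \<phi> (g <#\<^bsub>G\<^esub> H)" if "g \<in> S" for g
    unfolding \<phi>_def using that finS u_pos u_nonneg by (intro sum_pos2[of _ g]) auto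
  have N_nonneg: "0 \<le> N" by (simp add: N_def sum_nonneg)
  have norm_u: "ell_ennnorm q X (fiber_sum G H u) = ennreal (N powr (1 / q))"
    unfolding X N_def C_def \<phi>_def
    by (rule ell_ennnorm_fiber_sum[OF finS SG u_nonneg u_zero])
  \<comment> \<open>The weight is constant on each fiber. With \<open>r = q - 1\<close> the result
    is \<open>\<phi> x powr q\<close>; with \<open>r = q / 2 - 1\<close> it is the square root of
    that, so the \<open>\<ell>^1\<close> and \<open>\<ell>^2\<close> computations both lead to
    \<open>N\<close>.\<close>
  have fiber_powr: "(\<Sum>g | g \<in> S \<and> g <#\<^bsub>G\<^esub> H = x. u g * \<phi> (g <#\<^bsub>G\<^esub> H) powr r) = \<phi> x powr (1 + r)"
    if "x \<in> C" for x r
  proof -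
    have "(\<Sum>g | g \<in> S \<and> g <#\<^bsub>G\<^esub> H = x. u g * \<phi> (g <#\<^bsub>G\<^esub> H) powr r) = \<phi> x * \<phi> x powr r"
      by (simp add: \<phi>_def sum_distrib_right)
    also have "\<dots> = \<phi> x powr (1 + r)"
      using \<phi>_pos that by (auto simp: C_def powr_add less_imp_le)
    finally show ?thesis .
  qed
  obtain m where m: "M0 = ennreal m" "0 \<le> m"
    using \<open>M0 < \<infinity>\<close> by (cases M0) auto
  have w_le: "w g powr (- \<beta>0) \<le> m" if "g \<in> carrier G" for g
  proof -
    have "ennreal \<bar>w g powr (- \<beta>0)\<bar> \<le> M0"
      unfolding \<open>M0 = ell_inf_norm (carrier G) (\<lambda>g. w g powr (- \<beta>0))\<close> ell_inf_norm_def
      using that by (rule SUP_upper)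
    then show ?thesis using m by (simp add: ennreal_le_iff)
  qed
  \<comment> \<open>\<open>c0\<close> and \<open>c1\<close> are the coefficients of
    \<open>f0\<close> and \<open>f1\<close> from the introductory sketch, with the weights divided
    out.\<close>
  define c0 where "c0 g = cmod (f g) * w g powr (\<beta>\<theta> - \<beta>0) * \<phi> (g <#\<^bsub>G\<^esub> H) powr (q - 1)" for g
  define c1 where "c1 g = cmod (f g) * w g powr (\<beta>\<theta> - \<beta>1) * \<phi> (g <#\<^bsub>G\<^esub> H) powr (q / 2 - 1)" for g
  have c_nonneg: "0 \<le> c0 g" "0 \<le> c1 g" for g by (auto simp: c0_def c1_def)
  have c_interp: "cmod (f g) = c0 g powr (1 - \<theta>) * c1 g powr \<theta>" if "g \<in> S" for g
  proof -
    have pos: "0 < cmod (f g)" "0 < w g" "0 < \<phi> (g <#\<^bsub>G\<^esub> H)"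
      using that SG w[of g] \<phi>_pos[OF that] by (auto simp: S_def)
    have w_exp: "(\<beta>\<theta> - \<beta>0) * (1 - \<theta>) + (\<beta>\<theta> - \<beta>1) * \<theta> = 0"
      using \<open>\<beta>\<theta> = (1 - \<theta>) * \<beta>0 + \<theta> * \<beta>1\<close> by (simp add: algebra_simps)
    have \<phi>_exp: "(q - 1) * (1 - \<theta>) + (q / 2 - 1) * \<theta> = 0"
      using q_sum by (simp add: algebra_simps)
    have "c0 g powr (1 - \<theta>) * c1 g powr \<theta>
        = cmod (f g) powr ((1 - \<theta>) + \<theta>)
          * w g powr ((\<beta>\<theta> - \<beta>0) * (1 - \<theta>) + (\<beta>\<theta> - \<beta>1) * \<theta>)
          * \<phi> (g <#\<^bsub>G\<^esub> H) powr ((q - 1) * (1 - \<theta>) + (q / 2 - 1) * \<theta>)"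
      unfolding powr_add using pos by (simp add: c0_def c1_def powr_mult powr_powr mult_ac)
    also have "\<dots> = cmod (f g)"
      unfolding w_exp \<phi>_exp using pos by simp
    finally show ?thesis by simp
  qed
  have sum_c0: "(\<Sum>g\<in>S. c0 g) \<le> m * N"
  proof -
    have "c0 g \<le> m * (u g * \<phi> (g <#\<^bsub>G\<^esub> H) powr (q - 1))" if "g \<in> S" for g
    proof -
      have "c0 g = w g powr (- \<beta>0) * (u g * \<phi> (g <#\<^bsub>G\<^esub> H) powr (q - 1))"
        by (simp add: c0_def u_def powr_diff powr_minus field_simps)
      then show ?thesis
        using that SG w_le[of g] u_nonneg by (auto intro!: mult_right_mono)
    qed
    then have "(\<Sum>g\<in>S. c0 g) \<le> m * (\<Sum>g\<in>S. u g * \<phi> (g <#\<^bsub>G\<^esub> H) powr (q - 1))"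
      unfolding sum_distrib_left by (rule sum_mono)
    \<comment> \<open>\<open>S\<close> is partitioned into its fibers over \<open>C\<close>, and
      \<open>fiber_powr\<close> evaluates each of them.\<close>
    also have "(\<Sum>g\<in>S. u g * \<phi> (g <#\<^bsub>G\<^esub> H) powr (q - 1)) = N"
      unfolding N_def sum.image_gen[OF finS, of _ "\<lambda>g. g <#\<^bsub>G\<^esub> H"] C_def[symmetric]
      by (rule sum.cong[OF refl], subst fiber_powr) simp_all
    finally show ?thesis .
  qed
  define f1 where "f1 g = complex_of_real (c1 g)" for g
  \<comment> \<open>Since \<open>quasi_regular_alg\<close> sums over the support of its coefficient
    function, equal supports let \<open>f\<close> and \<open>f1\<close> be compared term by term
    over \<open>S\<close>.\<close>
  have f1_supp: "{g. f1 g \<noteq> 0} = S"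
  proof (rule Set.set_eqI)
    fix g
    show "g \<in> {g. f1 g \<noteq> 0} \<longleftrightarrow> g \<in> S"
    proof (cases "g \<in> S")
      case True
      then have "w g \<noteq> 0" "\<phi> (g <#\<^bsub>G\<^esub> H) \<noteq> 0" "f g \<noteq> 0"
        using \<phi>_pos[of g] w[of g] SG by (auto simp: S_def)
      then show ?thesis using True by (simp add: f1_def c1_def)
    next
      case False
      then show ?thesis by (simp add: f1_def c1_def S_def)
    qed
  qed
  then have f1: "f1 \<in> group_algebra G"
    using finS SG by (simp add: group_algebra_def)
  have norm_f1: "ell_ennnorm 2 X (fiber_sum G H (\<lambda>g. cmod (f1 g) * w g powr \<beta>1))
                  = ennreal (N powr (1 / 2))"
  proof -
    have f1_eq: "cmod (f1 g) * w g powr \<beta>1 = u g * \<phi> (g <#\<^bsub>G\<^esub> H) powr (q / 2 - 1)" for g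
    proof (cases "g \<in> S")
      case True
      then have "0 < w g" using SG w by auto
      moreover have "cmod (f1 g) = c1 g"
        using c_nonneg(2)[of g] by (simp add: f1_def)
      ultimately show ?thesis
        by (simp add: c1_def u_def powr_diff)
    qed (simp add: f1_def c1_def u_def S_def)
    have "(\<Sum>x\<in>C. (\<Sum>g | g \<in> S \<and> g <#\<^bsub>G\<^esub> H = x. u g * \<phi> (g <#\<^bsub>G\<^esub> H) powr (q / 2 - 1)) powr 2) = N"
      unfolding N_def by (rule sum.cong[OF refl], subst fiber_powr) (simp_all add: powr_powr del: powr_numeral)
    then show ?thesis
      unfolding f1_eq X C_def using ell_ennnorm_fiber_sum[OF finS SG, of "\<lambda>g. u g * \<phi> (g <#\<^bsub>G\<^esub> H) powr (q / 2 - 1)" 2 H]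
      using u_nonneg u_zero by simp
  qed
  define B where "B = m powr (1 - \<theta>) * M1 powr \<theta> * N powr (1 / q)"
  have B_nonneg: "0 \<le> B" by (simp add: B_def)
  have "ell_norm q X (quasi_regular_alg G f \<xi>) \<le> ennreal B" if \<xi>: "ell_norm q X \<xi> \<le> 1" for \<xi>
  proof -
    define \<eta> where "\<eta> x = cmod (\<xi> x) powr q" for x
    define \<xi>1 where "\<xi>1 x = complex_of_real (cmod (\<xi> x) powr (q / 2))" for x
    have sum_\<eta>: "(\<Sum>x\<in>A. \<eta> x) \<le> 1" if "finite A" "A \<subseteq> X" for A
      using \<xi> ell_norm_le_iff[of q 1 X \<xi>] q that by (auto simp: \<eta>_def)
    \<comment> \<open>The square of \<open>\<xi>1\<close> is \<open>\<eta>\<close>, so its finite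
      partial sums are those already bounded by \<open>sum_\<eta>\<close>.\<close>
    have norm_\<xi>1: "ell_norm 2 X \<xi>1 \<le> 1"
      using sum_\<eta> ell_norm_le_iff[of 2 1 X \<xi>1]
      by (simp add: \<xi>1_def \<eta>_def powr_powr del: powr_numeral)
    then have \<xi>1: "\<xi>1 \<in> ell_space 2 X"
      by (auto simp: ell_space_def intro: le_less_trans)
    define T0 where "T0 x = (\<Sum>g\<in>S. c0 g * \<eta> (inv\<^bsub>G\<^esub> g <#\<^bsub>G\<^esub> x))" for x
    define T1 where "T1 x = (\<Sum>g\<in>S. c1 g * cmod (\<xi> (inv\<^bsub>G\<^esub> g <#\<^bsub>G\<^esub> x)) powr (q / 2))" for x
    have T_nonneg: "0 \<le> T0 x" "0 \<le> T1 x" for x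
      using c_nonneg by (auto simp: T0_def T1_def \<eta>_def intro!: sum_nonneg)
    \<comment> \<open>As \<open>f1\<close> and \<open>\<xi>1\<close> are nonnegative, nothing
      cancels, and the assumed operator bound in \<open>\<ell>^2\<close> controls the positive sum
      \<open>T1\<close> itself.\<close>
    have T1_eq: "quasi_regular_alg G f1 \<xi>1 x = complex_of_real (T1 x)" for x
      unfolding quasi_regular_alg_def quasi_regular_def f1_supp
      by (simp add: T1_def f1_def \<xi>1_def)
    have "ell_norm 2 X (quasi_regular_alg G f1 \<xi>1)
            \<le> ennreal M1 * ennreal (N powr (1 / 2)) * ell_norm 2 X \<xi>1"
      using assms(14)[OF f1 \<xi>1] unfolding norm_f1 .
    also have "\<dots> \<le> ennreal M1 * ennreal (N powr (1 / 2)) * 1"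
      by (intro mult_left_mono norm_\<xi>1) auto
    also have "\<dots> = ennreal (M1 * N powr (1 / 2))"
      using \<open>0 < M1\<close> by (simp add: ennreal_mult)
    finally have T1_norm: "ell_norm 2 X (quasi_regular_alg G f1 \<xi>1) \<le> ennreal (M1 * N powr (1 / 2))" .
    have sum_T1: "(\<Sum>x\<in>A. T1 x powr 2) \<le> M1 powr 2 * N" if "finite A" "A \<subseteq> X" for A
    proof -
      have "(\<Sum>x\<in>A. cmod (quasi_regular_alg G f1 \<xi>1 x) powr 2) \<le> (M1 * N powr (1 / 2)) powr 2"
        using T1_norm that ell_norm_le_iff[of 2 "M1 * N powr (1 / 2)" X] \<open>0 < M1\<close> by auto
      also have "\<dots> = M1 powr 2 * N"
        using N_nonneg \<open>0 < M1\<close> by (simp add: powr_mult powr_powr del: powr_numeral)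
      finally show ?thesis
        unfolding T1_eq using T_nonneg by simp
    qed
    have sum_T0: "(\<Sum>x\<in>A. T0 x) \<le> m * N" if "finite A" "A \<subseteq> X" for A
      unfolding T0_def using c_nonneg sum_\<eta> that X
      by (intro order_trans[OF sum_quasi_regular_le[OF H finS SG] sum_c0]) auto
    have pointwise: "cmod (quasi_regular_alg G f \<xi> x) \<le> T0 x powr (1 - \<theta>) * T1 x powr \<theta>" for x
    proof -
      have \<xi>_interp: "cmod (\<xi> y) = \<eta> y powr (1 - \<theta>) * (cmod (\<xi> y) powr (q / 2)) powr \<theta>" for y
      proof -
        have "q * (1 - \<theta>) + q / 2 * \<theta> = 1" using q_sum by (simp add: algebra_simps)
        then show ?thesis
          by (simp add: \<eta>_def powr_powr flip: powr_add)
      qed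
      have "cmod (quasi_regular_alg G f \<xi> x)
              \<le> (\<Sum>g\<in>S. cmod (f g) * cmod (\<xi> (inv\<^bsub>G\<^esub> g <#\<^bsub>G\<^esub> x)))"
        unfolding quasi_regular_alg_def quasi_regular_def S_def
        by (rule order_trans[OF norm_sum]) (simp add: norm_mult)
      also have "\<dots> = (\<Sum>g\<in>S. (c0 g * \<eta> (inv\<^bsub>G\<^esub> g <#\<^bsub>G\<^esub> x)) powr (1 - \<theta>)
                         * (c1 g * cmod (\<xi> (inv\<^bsub>G\<^esub> g <#\<^bsub>G\<^esub> x)) powr (q / 2)) powr \<theta>)"
      proof (rule sum.cong[OF refl])
        fix g assume g: "g \<in> S"
        show "cmod (f g) * cmod (\<xi> (inv\<^bsub>G\<^esub> g <#\<^bsub>G\<^esub> x))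
            = (c0 g * \<eta> (inv\<^bsub>G\<^esub> g <#\<^bsub>G\<^esub> x)) powr (1 - \<theta>)
              * (c1 g * cmod (\<xi> (inv\<^bsub>G\<^esub> g <#\<^bsub>G\<^esub> x)) powr (q / 2)) powr \<theta>"
          by (subst c_interp[OF g], subst \<xi>_interp)
            (use c_nonneg in \<open>simp add: powr_mult \<eta>_def\<close>)
      qed
      also have "\<dots> \<le> T0 x powr (1 - \<theta>) * T1 x powr \<theta>"
        unfolding T0_def T1_def using \<theta> c_nonneg
        by (intro Holder_sum_powr) (auto simp: \<eta>_def)
      finally show ?thesis .
    qed
    have "(\<Sum>x\<in>A. cmod (quasi_regular_alg G f \<xi> x) powr q) \<le> B powr q"
      if A: "finite A" "A \<subseteq> X" for A
    proof -
      let ?s = "(1 - \<theta>) * q" and ?t = "\<theta> * q / 2"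
      have "(\<Sum>x\<in>A. cmod (quasi_regular_alg G f \<xi> x) powr q)
              \<le> (\<Sum>x\<in>A. (T0 x powr (1 - \<theta>) * T1 x powr \<theta>) powr q)"
        using q by (intro sum_mono powr_mono2 pointwise) auto
      \<comment> \<open>Writing \<open>T1\<close> through its square puts the factors in Hoelder
        form: \<open>?s + ?t = 1\<close>, with \<open>T0\<close> summed to the first power and
        \<open>T1\<close> to the second.\<close>
      also have "\<dots> = (\<Sum>x\<in>A. T0 x powr ?s * (T1 x powr 2) powr ?t)"
        using T_nonneg by (simp add: powr_mult powr_powr del: powr_numeral)
      also have "\<dots> \<le> (\<Sum>x\<in>A. T0 x) powr ?s * (\<Sum>x\<in>A. T1 x powr 2) powr ?t"
        using \<theta> q q_sum T_nonneg by (intro Holder_sum_powr) auto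
      also have "\<dots> \<le> (m * N) powr ?s * (M1 powr 2 * N) powr ?t"
        using \<theta> q T_nonneg sum_T0[OF A] sum_T1[OF A]
        by (intro mult_mono powr_mono2 sum_nonneg) auto
      also have "\<dots> = m powr ?s * (M1 powr 2) powr ?t * N powr (?s + ?t)"
        using N_nonneg m(2) unfolding powr_add by (simp add: powr_mult mult_ac)
      \<comment> \<open>The total exponent of \<open>N\<close> is \<open>?s + ?t = 1\<close>, which
        matches \<open>N powr (1 / q)\<close> raised to the power \<open>q\<close>.\<close>
      also have "\<dots> = B powr q"
        using N_nonneg q q_sum by (simp add: B_def powr_mult powr_powr del: powr_numeral)
      finally show ?thesis .
    qed
    then show ?thesis
      using q B_nonneg by (subst ell_norm_le_iff) auto
  qed
  then have "ell_opnorm q X (quasi_regular_alg G f) \<le> ennreal B"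
    unfolding ell_opnorm_def by (intro SUP_least) auto
  also have "ennreal B = ennpowr M0 (1 - \<theta>) * ennreal (M1 powr \<theta>)
                 * ell_ennnorm q X (fiber_sum G H u)"
    using m by (simp add: norm_u B_def ennpowr_ennreal ennreal_mult)
  finally show "ell_opnorm q X (quasi_regular_alg G f)
      \<le> ennpowr M0 (1 - \<theta>) * ennreal (M1 powr \<theta>)
          * ell_ennnorm q X (fiber_sum G H (\<lambda>g. cmod (f g) * w g powr \<beta>\<theta>))"
    unfolding u_def .
qed

end
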